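(* Assume (R1), let $[\dot f]_\infty>0$, and let $m\ge2$ be an integer. Put $C_V=\frac1m\sqrt{\frac{m+1}{K_{1,m}(m-1)T}}$ and $s=\frac{m(\sqrt m-1)}{m+1}C_V$. For $\varepsilon>0$, consider minimizing the computation cost $N_0+\sum_{\ell=1}^LN_\ell(m+1)m^{\ell-1}$ over integers $L\ge0$ and real numbers $N_0,\dots,N_L>0$ subject to $$[\dot f]_\infty^2\left(\frac{K_{1,\infty}T^2}{m^{2L}}+\frac T{N_0}+\sum_{\ell=1}^L\frac{K_{1,m}(m-1)T^2}{N_\ell m^{2\ell-1}}\right)\le\varepsilon^2.$$ (i) For fixed $L$ with $[\dot f]_\infty T\sqrt{K_{1,\infty}}\,m^{-L}<\varepsilon$, the minimum over $(N_\ell)_{0\le\ell\le L}$ is attained at $N_0=N\frac{C_V}{C_V+\sum_{l=1}^Lm^{-3l/2}}$, $N_\ell=N\frac{m^{-3\ell/2}}{C_V+\sum_{l=1}^Lm^{-3l/2}}$ ($1\le\ell\le L$), with $$N=\Big(C_V+\sum_{l=1}^Lm^{-3l/2}\Big)\Big(C_V+\tfrac{m+1}m\cdot\tfrac{1-m^{-L/2}}{\sqrt m-1}\Big)\frac{K_{1,m}m^2(m-1)[\dot f]_\infty^2T^2}{(m+1)(\varepsilon^2-[\dot f]_\infty^2T^2K_{1,\infty}m^{-2L})},$$ and equals $\Big(C_V+\tfrac{m+1}m\cdot\tfrac{1-m^{-L/2}}{\sqrt m-1}\Big)^2\frac{K_{1,m}m^2(m-1)[\dot f]_\infty^2T^2}{(m+1)(\varepsilon^2-[\dot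 f]_\infty^2T^2K_{1,\infty}m^{-2L})}$. (ii) If $0<\varepsilon<c_1:=[\dot f]_\infty T\sqrt{K_{1,\infty}}(1+2s)^{1/2}$, then any optimal value $L^\varepsilon$ of $L$ satisfies $$\frac{\varepsilon^{4/3}}{2^{2/3}m([\dot f]_\infty T\sqrt{K_{1,\infty}})^{4/3}(1+s)^{2/3}}<m^{-L^\varepsilon}<\frac{m\,\varepsilon^{4/3}}{(1+s)([\dot f]_\infty T\sqrt{K_{1,\infty}})^{4/3}}\left(\frac{(1+s)^{1/3}}{2^{2/3}}+\frac{(1+2s)^{1/3}}{1+4s}\right).$$ In particular the bias bound $[\dot f]_\infty T\sqrt{K_{1,\infty}}\,m^{-L^\varepsilon}$ is $\mathcal O(\varepsilon^{4/3})$ as $\varepsilon\to0$.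
   Context: $d\ge1$, $T\in(0,\infty)$, $x_0\in\mathbb R^d$, $b:\mathbb R^d\to\mathbb R^d$; $|\cdot|$ is the Euclidean norm, $\|\cdot\|$ the induced matrix norm, $\nabla b$ the Jacobian matrix, $\Delta b$ the coordinatewise Laplacian. Assumption (R1): $b\in\mathscr C^2(\mathbb R^d,\mathbb R^d)$ and there are constants $[\dot b]_\infty\in(0,\infty)$, $a_{\Delta b}\in[0,\infty)$ such that for all $x$, $\|\nabla b(x)\|\le[\dot b]_\infty$ and $|\Delta b(x)|\le2a_{\Delta b}(1+|x-x_0|)$. Constants: for $m\in\{2,3,\dots\}\cup\{\infty\}$ (ratios in $m$ being replaced by their limits when $m=\infty$), with $C_A=\sqrt T+[\dot b]_\infty\int_0^Te^{[\dot b]_\infty(T-t)}\sqrt t\,dt$, $$\sqrt{K_{1,m}}=C_A[\dot b]_\infty\sqrt{\tfrac{d(2m-1)}{6m}}+e^{[\dot b]_\infty T}\sqrt{\tfrac{m-1}m}\Big(\tfrac{|b(x_0)|}2\big(a_{\Delta b}\tfrac{[\dot b]_\infty T-1+e^{-[\dot b]_\infty T}}{[\dot b]_\infty^2}+[\dot b]_\infty T\big)+a_{\Delta b}\tfrac{1-e^{-[\dot b]_\infty T}}{[\dot b]_\infty}+\tfrac23\sqrt d([\dot b]_\infty^2+a_{\Delta b})T^{3/2}\Big).$$ (The constraint is the upper bound of the mean square error of the multilevel Monte Carlo Euler estimator of $\mathbb E[f(X_T)]$, $dX_t=b(X_t)dt+dW_t$, $X_0=x_0$, for $f$ Lipschitz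 with constant $[\dot f]_\infty$; $[\dot f]_\infty T\sqrt{K_{1,\infty}}m^{-L}$ is the bound of its bias.) *)

theory Defs
  imports
    "HOL-Analysis.Analysis"
    "HOL-Library.Extended_Nat"
    "HOL-Library.Landau_Symbols"
begin

definition C2_map :: "('a::real_normed_vector \<Rightarrow> 'b::real_normed_vector) \<Rightarrow> bool" where
  "C2_map f \<longleftrightarrow>
     (\<exists>(f' :: 'a \<Rightarrow> 'a \<Rightarrow>\<^sub>L 'b) (f'' :: 'a \<Rightarrow> 'a \<Rightarrow>\<^sub>L ('a \<Rightarrow>\<^sub>L 'b)).
        (\<forall>x. (f has_derivative blinfun_apply (f' x)) (at x)) \<and>
        (\<forall>x. (f' has_derivative blinfun_apply (f'' x)) (at x)) \<and>
        continuous_on UNIV f'')"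

definition partial_deriv :: "'d::finite \<Rightarrow> (real ^ 'd \<Rightarrow> real) \<Rightarrow> real ^ 'd \<Rightarrow> real" where
  "partial_deriv j g x = deriv (\<lambda>t. g (x + t *\<^sub>R axis j 1)) 0"

definition vec_laplacian :: "(real ^ 'd \<Rightarrow> real ^ 'd) \<Rightarrow> real ^ 'd \<Rightarrow> real ^ 'd" where
  "vec_laplacian b x =
     (\<chi> i. \<Sum>j\<in>UNIV. partial_deriv j (partial_deriv j (\<lambda>y. b y $ i)) x)"

(* The norm on the type real ^ 'd ^ 'd is the Frobenius norm, hence onorm for the
   matrix norm induced by the Euclidean norm. *)
definition R1 :: "(real ^ 'd \<Rightarrow> real ^ 'd) \<Rightarrow> real ^ 'd \<Rightarrow> real \<Rightarrow> real \<Rightarrow> bool" where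
  "R1 b x0 bdot a \<longleftrightarrow>
     C2_map b \<and> 0 < bdot \<and> 0 \<le> a \<and>
     (\<forall>x. onorm (\<lambda>v. jacobian b (at x) *v v) \<le> bdot) \<and>
     (\<forall>x. norm (vec_laplacian b x) \<le> 2 * a * (1 + norm (x - x0)))"

definition C_A :: "real \<Rightarrow> real \<Rightarrow> real" where
  "C_A bdot T = sqrt T + bdot * integral {0..T} (\<lambda>t. exp (bdot * (T - t)) * sqrt t)"

(* At infinity the two ratios in m take their limits 1/3 and 1. *)
definition ratio1 :: "enat \<Rightarrow> real" where
  "ratio1 m = (case m of enat n \<Rightarrow> (2 * real n - 1) / (6 * real n) | \<infinity> \<Rightarrow> 1 / 3)"

definition ratio2 :: "enat \<Rightarrow> real" where
  "ratio2 m = (case m of enat n \<Rightarrow> (real n - 1) / real n | \<infinity> \<Rightarrow> 1)"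

definition sqrt_K1 ::
  "(real ^ 'd \<Rightarrow> real ^ 'd) \<Rightarrow> real ^ 'd \<Rightarrow> real \<Rightarrow> real \<Rightarrow> real \<Rightarrow> enat \<Rightarrow> real" where
  "sqrt_K1 b x0 bdot a T m =
     C_A bdot T * bdot * sqrt (real CARD('d) * ratio1 m)
     + exp (bdot * T) * sqrt (ratio2 m) *
       (norm (b x0) / 2 * (a * ((bdot * T - 1 + exp (- bdot * T)) / bdot\<^sup>2) + bdot * T)
        + a * ((1 - exp (- bdot * T)) / bdot)
        + 2 / 3 * sqrt (real CARD('d)) * (bdot\<^sup>2 + a) * T powr (3 / 2))"

definition K1 ::
  "(real ^ 'd \<Rightarrow> real ^ 'd) \<Rightarrow> real ^ 'd \<Rightarrow> real \<Rightarrow> real \<Rightarrow> real \<Rightarrow> enat \<Rightarrow> real" where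
  "K1 b x0 bdot a T m = (sqrt_K1 b x0 bdot a T m)\<^sup>2"

(* Only the values N 0, ..., N L of an allocation N are relevant. *)
definition mlmc_cost :: "nat \<Rightarrow> nat \<Rightarrow> (nat \<Rightarrow> real) \<Rightarrow> real" where
  "mlmc_cost m L N = N 0 + (\<Sum>l=1..L. N l * (real m + 1) * real m ^ (l - 1))"

(* K and Kinf stand for the constants K1 at m and at infinity. *)
definition mse_bound ::
  "real \<Rightarrow> real \<Rightarrow> real \<Rightarrow> real \<Rightarrow> nat \<Rightarrow> nat \<Rightarrow> (nat \<Rightarrow> real) \<Rightarrow> real" where
  "mse_bound fdot T K Kinf m L N =
     fdot\<^sup>2 * (Kinf * T\<^sup>2 / real m ^ (2 * L) + T / N 0
       + (\<Sum>l=1..L. K * (real m - 1) * T\<^sup>2 / (N l * real m ^ (2 * l - 1))))"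

definition mlmc_feasible ::
  "real \<Rightarrow> real \<Rightarrow> real \<Rightarrow> real \<Rightarrow> nat \<Rightarrow> real \<Rightarrow> nat \<Rightarrow> (nat \<Rightarrow> real) \<Rightarrow> bool" where
  "mlmc_feasible fdot T K Kinf m \<epsilon> L N \<longleftrightarrow>
     (\<forall>l\<le>L. 0 < N l) \<and> mse_bound fdot T K Kinf m L N \<le> \<epsilon>\<^sup>2"

definition optimal_level ::
  "real \<Rightarrow> real \<Rightarrow> real \<Rightarrow> real \<Rightarrow> nat \<Rightarrow> real \<Rightarrow> nat \<Rightarrow> bool" where
  "optimal_level fdot T K Kinf m \<epsilon> L \<longleftrightarrow>
     (\<exists>N. is_arg_min (\<lambda>(L, N). mlmc_cost m L N)
            (\<lambda>(L, N). mlmc_feasible fdot T K Kinf m \<epsilon> L N) (L, N))"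

end

theory Submission
  imports Defs
begin

text \<open>For fixed \<open>L\<close>, write the cost as \<open>\<Sum>c\<^sub>l N\<^sub>l\<close> and the variance as a multiple of
  \<open>\<Sum>c\<^sub>l w\<^sub>l\<^sup>2 / N\<^sub>l\<close>; Cauchy--Schwarz gives the minimum, attained for \<open>N\<^sub>l\<close> proportional to \<open>w\<^sub>l\<close>.
  With \<open>u = m\<^sup>-\<^sup>L\<^sup>/\<^sup>2\<close>, \<open>a = 1 + s\<close> and \<open>D = (\<epsilon> / A)\<^sup>2\<close>, the minimal cost is a constant multiple of
  \<open>(a - u)\<^sup>2 / (D - u\<^sup>4)\<close>, which decreases in \<open>u\<close> up to the root of \<open>2 a u\<^sup>3 - u\<^sup>4 = D\<close> and then increases.
  Comparing an optimal \<open>L\<close> with \<open>L + 1\<close> and \<open>L - 1\<close> therefore encloses this root between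
  \<open>u / \<surd>m\<close> and \<open>u \<surd>m\<close>.\<close>

section \<open>Positivity of the constants \<open>K1\<close>\<close>

lemma C_A_pos:
  assumes "0 < T" "0 < bdot"
  shows "0 < C_A bdot T"
proof -
  have "0 \<le> integral {0..T} (\<lambda>t. exp (bdot * (T - t)) * sqrt t)"
    by (rule integral_nonneg) (auto intro!: integrable_continuous_real continuous_intros)
  then show ?thesis
    using assms unfolding C_A_def by (intro add_pos_nonneg mult_nonneg_nonneg) auto
qed

text \<open>The first summand is strictly positive because \<open>C_A\<close> is. The second is
  nonnegative; the sign of its least obvious coefficient comes from
  \<open>exp (- x) \<ge> 1 - x\<close>.\<close>

lemma sqrt_K1_pos:
  fixes b :: "real ^ 'd \<Rightarrow> real ^ 'd"
  assumes "0 < T" "0 < bdot" "0 \<le> a" "0 < ratio1 k" "0 \<le> ratio2 k"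
  shows "0 < sqrt_K1 b x0 bdot a T k"
proof -
  have "0 \<le> bdot * T - 1 + exp (- bdot * T)"
    using exp_ge_add_one_self[of "- bdot * T"] by simp
  moreover have "0 \<le> 1 - exp (- bdot * T)"
    using assms by simp
  ultimately show ?thesis
    unfolding sqrt_K1_def using assms C_A_pos[of T bdot]
    by (intro add_pos_nonneg mult_pos_pos mult_nonneg_nonneg add_nonneg_nonneg) auto
qed

text \<open>With \<open>k\<close> in \<open>enat\<close>, one statement serves both
  \<open>k = enat m\<close> and \<open>k = \<infinity>\<close>.\<close>

lemma K1_pos:
  fixes b :: "real ^ 'd \<Rightarrow> real ^ 'd"
  assumes "0 < T" "R1 b x0 bdot a" "2 \<le> k"
  shows "0 < K1 b x0 bdot a T k"
proof -
  have "0 < ratio1 k" "0 \<le> ratio2 k"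
    using assms(3) by (cases k; auto simp: ratio1_def ratio2_def numeral_eq_enat)+
  then show ?thesis
    using assms sqrt_K1_pos[of T bdot a k b x0] by (simp add: K1_def R1_def)
qed

section \<open>Real inequalities for sums, quotients and powers\<close>

lemma powr_minus_half_nat:
  assumes "0 < x"
  shows "x powr (- (real k / 2)) = 1 / sqrt x ^ k"
  using assms
  by (simp add: powr_minus_divide powr_half_sqrt[symmetric] powr_realpow[symmetric] powr_powr)

text \<open>Cauchy--Schwarz for the vectors \<open>sqrt (c i * N i)\<close> and
  \<open>sqrt (c i / N i) * w i\<close>. The right side will be cost times scaled variance, while
  the left side does not involve the allocation \<open>N\<close>.\<close>

lemma weighted_Cauchy_Schwarz:
  fixes c w N :: "'i \<Rightarrow> real"
  assumes "\<And>i. i \<in> I \<Longrightarrow> 0 \<le> c i" "\<And>i. i \<in> I \<Longrightarrow> 0 < N i"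
  shows "(\<Sum>i\<in>I. c i * w i)\<^sup>2 \<le> (\<Sum>i\<in>I. c i * N i) * (\<Sum>i\<in>I. c i * (w i)\<^sup>2 / N i)"
proof -
  have "sqrt (c i * N i) * (sqrt (c i / N i) * w i) = c i * w i" if "i \<in> I" for i
  proof -
    have "sqrt (c i * N i) * sqrt (c i / N i) = sqrt (c i * c i)"
      using assms[OF that] by (simp flip: real_sqrt_mult)
    then show ?thesis
      using assms(1)[OF that] by (simp flip: mult.assoc)
  qed
  then have "(\<Sum>i\<in>I. c i * w i) = (\<Sum>i\<in>I. sqrt (c i * N i) * (sqrt (c i / N i) * w i))"
    by (metis (no_types, lifting) sum.cong)
  also have "\<dots>\<^sup>2 \<le> (\<Sum>i\<in>I. (sqrt (c i * N i))\<^sup>2) * (\<Sum>i\<in>I. (sqrt (c i / N i) * w i)\<^sup>2)"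
    by (rule Cauchy_Schwarz_ineq_sum)
  also have "\<dots> = (\<Sum>i\<in>I. c i * N i) * (\<Sum>i\<in>I. c i * (w i)\<^sup>2 / N i)"
    using assms by (intro arg_cong2[where f="(*)"] sum.cong)
      (auto simp: power_mult_distrib less_imp_le)
  finally show ?thesis .
qed

text \<open>The critical points of \<open>(a - u)\<^sup>2 / (D - u\<^sup>4)\<close> are the roots of \<open>2 a u\<^sup>3 - u\<^sup>4 = D\<close>;
  on the relevant range, the last hypothesis puts \<open>p\<close> between the critical point and \<open>q\<close>.\<close>
lemma quotient_less:
  fixes a D p q :: real
  assumes "0 < p" "p < a" "q < a" "p \<noteq> q" "p ^ 4 < D" "q ^ 4 < D"
    and "0 \<le> (q - p) * (2 * a * p ^ 3 - p ^ 4 - D)"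
  shows "(a - p)\<^sup>2 / (D - p ^ 4) < (a - q)\<^sup>2 / (D - q ^ 4)"
proof -
  \<comment> \<open>The cross-multiplied difference, expanded around \<open>p\<close>. The first
    term carries the factor \<open>2 * a * p ^ 3 - p ^ 4 - D\<close>, which has the sign of the
    derivative at \<open>p\<close>; the remainder is of second order in \<open>q - p\<close> with a
    positive cofactor.\<close>
  have "(a - q)\<^sup>2 * (D - p ^ 4) - (a - p)\<^sup>2 * (D - q ^ 4)
      = (q - p) * (2 * a * p ^ 3 - p ^ 4 - D) * ((a - p) + (a - q))
        + (a - p) * (q - p)\<^sup>2 * (2 * p ^ 3 + (a - p) * (2 * p\<^sup>2 + (p + q)\<^sup>2))"
    by algebra
  also have "\<dots> > 0"
  proof (intro add_nonneg_pos)
    show "0 \<le> (q - p) * (2 * a * p ^ 3 - p ^ 4 - D) * ((a - p) + (a - q))"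
      using assms by (intro mult_nonneg_nonneg[of "_ * _"]) linarith+
    show "0 < (a - p) * (q - p)\<^sup>2 * (2 * p ^ 3 + (a - p) * (2 * p\<^sup>2 + (p + q)\<^sup>2))"
      using assms by (intro mult_pos_pos add_pos_nonneg) auto
  qed
  finally show ?thesis
    using assms by (simp add: divide_simps mult.commute)
qed

text \<open>With \<open>a = 1 + s\<close>, this compares the natural constant
  \<open>1 / (1 + 2 * s) powr (2 / 3)\<close> with the less transparent one of the stated upper
  bound. After multiplying out, the two summands contribute at least \<open>a - 1 / 2\<close> and
  more than \<open>1 / 2\<close>.\<close>

lemma upper_constant_gt:
  fixes a :: real
  assumes "1 < a"
  shows "a < (2 * a - 1) powr (2 / 3)
            * (a powr (1 / 3) / 2 powr (2 / 3) + (2 * a - 1) powr (1 / 3) / (4 * a - 3))"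
proof -
  \<comment> \<open>The first product equals \<open>a * t powr (2 / 3)\<close>. Since
    \<open>t \<le> 1\<close>, this is at least \<open>a * t = a - 1 / 2\<close>.\<close>
  define t where "t = (2 * a - 1) / (2 * a)"
  have t: "0 < t" "t \<le> 1" "a * t = a - 1 / 2"
    using assms by (auto simp: t_def field_simps)
  have "t \<le> t powr (2 / 3)"
    using powr_mono'[of "2 / 3" 1 t] t by simp
  then have "a - 1 / 2 \<le> a * t powr (2 / 3)"
    using assms t(3) by (metis less_eq_real_def mult_left_mono order_less_trans zero_less_one)
  also have "\<dots> = (2 * a - 1) powr (2 / 3) * (a powr (1 / 3) / 2 powr (2 / 3))"
  proof -
    have "a = a powr (1 / 3) * a powr (2 / 3)"
      using assms by (simp flip: powr_add)
    then show ?thesis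
      using assms by (simp add: t_def powr_divide powr_mult field_simps)
  qed
  finally have 1: "a - 1 / 2 \<le> (2 * a - 1) powr (2 / 3) * (a powr (1 / 3) / 2 powr (2 / 3))" .
  have "(2 * a - 1) powr (2 / 3) * (2 * a - 1) powr (1 / 3) = 2 * a - 1"
    using assms by (simp flip: powr_add)
  then have "(2 * a - 1) powr (2 / 3) * ((2 * a - 1) powr (1 / 3) / (4 * a - 3))
      = (2 * a - 1) / (4 * a - 3)"
    by simp
  also have "\<dots> > 1 / 2"
    using assms by (simp add: field_simps)
  finally show ?thesis
    using 1 by (simp only: distrib_left)
qed

lemma cube_powr_two_thirds:
  fixes x :: real
  assumes "0 < x"
  shows "(x ^ 3) powr (2 / 3) = x\<^sup>2"
proof -
  have "(x powr 3) powr (2 / 3) = x powr 2"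
    by (simp only: powr_powr) simp
  then show ?thesis
    using assms by simp
qed

lemma square_powr_two_thirds:
  fixes x :: real
  assumes "0 < x"
  shows "(x\<^sup>2) powr (2 / 3) = x powr (4 / 3)"
proof -
  have "(x powr 2) powr (2 / 3) = x powr (4 / 3)"
    by (simp only: powr_powr) simp
  then show ?thesis
    using assms by simp
qed

section \<open>The optimization problem for arbitrary positive constants \<open>K\<close> and
  \<open>Kinf\<close>, detached from the drift\<close>

locale mlmc =
  fixes m :: nat and T K Kinf fdot :: real
  assumes m_ge: "2 \<le> m" and T_pos: "0 < T" and K_pos: "0 < K" and Kinf_pos: "0 < Kinf"
    and fdot_pos: "0 < fdot"
begin

definition CV :: real where
  "CV = 1 / real m * sqrt ((real m + 1) / (K * (real m - 1) * T))"

definition s :: real where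
  "s = real m * (sqrt (real m) - 1) / (real m + 1) * CV"

definition A :: real where
  "A = fdot * T * sqrt Kinf"

text \<open>The proportions of the optimal allocation. The value \<open>CV\<close> at 0 is the one
  for which level 0 has a variance of the same form as the other levels, with the same factor
  \<open>variance_scale\<close>.\<close>

definition weight :: "nat \<Rightarrow> real" where
  "weight l = (if l = 0 then CV else real m powr (- (3 * real l / 2)))"

definition unit_cost :: "nat \<Rightarrow> real" where
  "unit_cost l = (if l = 0 then 1 else (real m + 1) * real m ^ (l - 1))"

text \<open>The common factor: level \<open>l\<close> contributes
  \<open>variance_scale * unit_cost l * (weight l)\<^sup>2 / N l\<close> to the variance.\<close>

definition variance_scale :: real where
  "variance_scale = K * (real m)\<^sup>2 * (real m - 1) * fdot\<^sup>2 * T\<^sup>2 / (real m + 1)"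

text \<open>The part of the error budget \<open>\<epsilon>\<^sup>2\<close> that the squared bias
  bound leaves to the variance.\<close>

definition gap :: "real \<Rightarrow> nat \<Rightarrow> real" where
  "gap \<epsilon> L = \<epsilon>\<^sup>2 - fdot\<^sup>2 * T\<^sup>2 * Kinf * real m powr (- (2 * real L))"

text \<open>Closed form of the geometric sum of \<open>unit_cost l * weight l\<close> over
  \<open>l \<le> L\<close>.\<close>

definition Q :: "nat \<Rightarrow> real" where
  "Q L = CV + (real m + 1) / real m
             * ((1 - real m powr (- (real L / 2))) / (sqrt (real m) - 1))"

definition opt_cost :: "real \<Rightarrow> nat \<Rightarrow> real" where
  "opt_cost \<epsilon> L = (Q L)\<^sup>2 * (variance_scale / gap \<epsilon> L)"

definition opt_alloc :: "real \<Rightarrow> nat \<Rightarrow> nat \<Rightarrow> real" where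
  "opt_alloc \<epsilon> L l = weight l * (Q L * (variance_scale / gap \<epsilon> L))"

text \<open>The half-integer powers of \<open>m\<close> become natural powers of \<open>r\<close>,
  which makes the later comparisons polynomial in \<open>1 / r ^ L\<close>.\<close>

abbreviation r :: real where "r \<equiv> sqrt (real m)"

lemma r_gt_1: "1 < r"
  using m_ge by simp

lemma r_squared: "r\<^sup>2 = real m"
  by simp

lemma CV_pos: "0 < CV"
  unfolding CV_def using m_ge T_pos K_pos by (intro mult_pos_pos) auto

lemma s_pos: "0 < s"
  unfolding s_def using m_ge r_gt_1 CV_pos by (intro mult_pos_pos divide_pos_pos) auto

lemma A_pos: "0 < A"
  unfolding A_def using T_pos Kinf_pos fdot_pos by simp

lemma A_squared: "A\<^sup>2 = fdot\<^sup>2 * T\<^sup>2 * Kinf"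
  using Kinf_pos by (simp add: A_def power_mult_distrib)

lemma variance_scale_pos: "0 < variance_scale"
  unfolding variance_scale_def using m_ge T_pos K_pos fdot_pos
  by (intro divide_pos_pos mult_pos_pos) auto

lemma weight_pos: "0 < weight l"
  using m_ge CV_pos by (simp add: weight_def)

lemma unit_cost_pos: "0 < unit_cost l"
  using m_ge by (auto simp: unit_cost_def)

lemma weight_Suc: "weight (Suc l) = 1 / r ^ (3 * Suc l)"
proof -
  have "real m powr (- (real (3 * Suc l) / 2)) = 1 / r ^ (3 * Suc l)"
    using m_ge by (intro powr_minus_half_nat) simp
  then show ?thesis
    by (simp add: weight_def del: power_Suc)
qed

section \<open>Cost and error bound in terms of unit costs and weights\<close>

lemma variance_weight_0: "variance_scale * (unit_cost 0 * (weight 0)\<^sup>2) = fdot\<^sup>2 * T"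
proof -
  have "CV\<^sup>2 = (real m + 1) / (K * (real m - 1) * T) / (real m)\<^sup>2"
    using m_ge T_pos K_pos by (simp add: CV_def power_mult_distrib power_divide)
  then show ?thesis
    using m_ge T_pos K_pos
    by (simp add: weight_def unit_cost_def variance_scale_def power2_eq_square)
qed

lemma variance_weight_Suc:
  "variance_scale * (unit_cost (Suc l) * (weight (Suc l))\<^sup>2)
     = fdot\<^sup>2 * (K * (real m - 1) * T\<^sup>2 / real m ^ (2 * Suc l - 1))"
proof -
  have "(r ^ (3 * Suc l))\<^sup>2 = (r\<^sup>2) ^ (3 * Suc l)"
    by (simp only: mult.commute flip: power_mult)
  \<comment> \<open>The exponent \<open>3 * Suc l\<close> is split into 2 for
    \<open>variance_scale\<close>, \<open>l\<close> for the unit cost, and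
    \<open>2 * Suc l - 1\<close> for the error bound.\<close>
  also have "\<dots> = real m ^ (2 + l + (2 * Suc l - 1))"
    by (simp add: numeral_eq_Suc)
  also have "\<dots> = (real m)\<^sup>2 * real m ^ l * real m ^ (2 * Suc l - 1)"
    by (simp only: power_add)
  finally have w: "(weight (Suc l))\<^sup>2 = 1 / ((real m)\<^sup>2 * real m ^ l * real m ^ (2 * Suc l - 1))"
    by (simp only: weight_Suc power_divide power_one)
  have c: "unit_cost (Suc l) = (real m + 1) * real m ^ l"
    by (simp add: unit_cost_def)
  define y where "y = real m ^ (2 * Suc l - 1)"
  have "y > 0" using m_ge by (simp add: y_def)
  then show ?thesis
    using m_ge unfolding w c variance_scale_def y_def[symmetric]
    by (simp add: divide_simps)
qed

lemma mlmc_cost_eq: "mlmc_cost m L N = (\<Sum>l\<le>L. unit_cost l * N l)"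
proof -
  have "(\<Sum>l\<le>L. unit_cost l * N l) = N 0 + (\<Sum>l=1..L. unit_cost l * N l)"
    by (simp add: atMost_atLeast0 sum.atLeast_Suc_atMost unit_cost_def)
  also have "(\<Sum>l=1..L. unit_cost l * N l)
      = (\<Sum>l=1..L. N l * (real m + 1) * real m ^ (l - 1))"
    by (intro sum.cong) (auto simp: unit_cost_def)
  finally show ?thesis
    by (simp add: mlmc_cost_def)
qed

text \<open>The difference \<open>\<epsilon>\<^sup>2 - gap \<epsilon> L\<close> is the squared bias
  bound, whatever \<epsilon> is. In this form the constraint says that the variance is at most
  \<open>gap \<epsilon> L\<close>.\<close>

lemma mse_bound_eq:
  "mse_bound fdot T K Kinf m L N
     = \<epsilon>\<^sup>2 - gap \<epsilon> L + variance_scale * (\<Sum>l\<le>L. unit_cost l * (weight l)\<^sup>2 / N l)"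
proof -
  have "variance_scale * (\<Sum>l\<le>L. unit_cost l * (weight l)\<^sup>2 / N l)
      = (\<Sum>l\<le>L. variance_scale * (unit_cost l * (weight l)\<^sup>2) / N l)"
    by (simp add: sum_distrib_left)
  also have "\<dots> = fdot\<^sup>2 * T / N 0
      + (\<Sum>l=1..L. variance_scale * (unit_cost l * (weight l)\<^sup>2) / N l)"
    by (simp add: atMost_atLeast0 sum.atLeast_Suc_atMost variance_weight_0)
  also have "(\<Sum>l=1..L. variance_scale * (unit_cost l * (weight l)\<^sup>2) / N l)
      = (\<Sum>l=1..L. fdot\<^sup>2 * (K * (real m - 1) * T\<^sup>2 / (N l * real m ^ (2 * l - 1))))"
  proof (intro sum.cong refl)
    fix l assume "l \<in> {1..L}"
    then obtain k where "l = Suc k" by (cases l) auto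
    then show "variance_scale * (unit_cost l * (weight l)\<^sup>2) / N l
        = fdot\<^sup>2 * (K * (real m - 1) * T\<^sup>2 / (N l * real m ^ (2 * l - 1)))"
      using variance_weight_Suc[of k] by (simp add: mult.commute)
  qed
  moreover have "\<epsilon>\<^sup>2 - gap \<epsilon> L = fdot\<^sup>2 * (Kinf * T\<^sup>2 / real m ^ (2 * L))"
  proof -
    have "real m powr (- (2 * real L)) = 1 / real m ^ (2 * L)"
      using m_ge powr_realpow[of "real m" "2 * L"] by (simp add: powr_minus_divide)
    then show ?thesis by (simp add: gap_def)
  qed
  ultimately show ?thesis
    by (simp add: mse_bound_def distrib_left sum_distrib_left)
qed

lemma mlmc_feasible_iff:
  "mlmc_feasible fdot T K Kinf m \<epsilon> L N \<longleftrightarrow>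
     (\<forall>l\<le>L. 0 < N l) \<and>
     variance_scale * (\<Sum>l\<le>L. unit_cost l * (weight l)\<^sup>2 / N l) \<le> gap \<epsilon> L"
  unfolding mlmc_feasible_def mse_bound_eq[where \<epsilon> = \<epsilon>] by auto

text \<open>For \<open>l \<ge> 1\<close> the summand is \<open>(m + 1) / m\<close> times
  \<open>1 / r ^ l\<close>, so the series is geometric; the induction step checks that it equals the
  increment of \<open>Q\<close>.\<close>

lemma sum_unit_cost_weight: "(\<Sum>l\<le>L. unit_cost l * weight l) = Q L"
proof (induction L)
  case 0
  show ?case using m_ge by (simp add: unit_cost_def weight_def Q_def)
next
  case (Suc L)
  have half: "real m powr (- (real k / 2)) = 1 / r ^ k" for k
    using m_ge by (intro powr_minus_half_nat) simp
  have "real m ^ L = (r ^ L)\<^sup>2"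
    by (simp add: power2_eq_square flip: power_mult_distrib)
  moreover have "r ^ (3 * Suc L) = r ^ L * (r ^ L)\<^sup>2 * (r\<^sup>2 * r)"
    by (simp only: flip: power_mult power_add power_Suc2) (simp add: algebra_simps)
  ultimately have "unit_cost (Suc L) * weight (Suc L) = (real m + 1) / (real m * (r ^ L * r))"
    using m_ge by (simp only: weight_Suc) (simp add: unit_cost_def power2_eq_square)
  also have "\<dots> = Q (Suc L) - Q L"
  proof -
    have "1 / (r ^ L * r) = (1 / r ^ L - 1 / (r ^ L * r)) / (r - 1)"
      using r_gt_1 by (simp add: divide_simps)
    then have "(real m + 1) / real m * (1 / (r ^ L * r))
        = (real m + 1) / real m * ((1 / r ^ L - 1 / (r ^ L * r)) / (r - 1))"
      by simp
    moreover have "Q (Suc L) - Q L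
        = (real m + 1) / real m * ((1 / r ^ L - 1 / (r ^ L * r)) / (r - 1))"
      unfolding Q_def half
      by (simp add: diff_divide_distrib right_diff_distrib)
    ultimately show ?thesis by simp
  qed
  finally show ?case using Suc by simp
qed

section \<open>Optimal allocation at a fixed level\<close>

lemma Q_pos: "0 < Q L"
  unfolding sum_unit_cost_weight[symmetric]
  using unit_cost_pos weight_pos by (intro sum_pos) auto

lemma gap_pos_iff:
  assumes "0 < \<epsilon>"
  shows "0 < gap \<epsilon> L \<longleftrightarrow> A * real m powr (- real L) < \<epsilon>"
proof -
  have "real m powr (- (2 * real L)) = (real m powr (- real L))\<^sup>2"
    using m_ge by (simp add: power2_eq_square flip: powr_add)
  then have "gap \<epsilon> L = \<epsilon>\<^sup>2 - (A * real m powr (- real L))\<^sup>2"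
    by (simp add: gap_def A_squared power_mult_distrib)
  then show ?thesis
    using assms A_pos by (simp add: abs_le_square_iff[symmetric] not_le[symmetric])
qed

text \<open>Every allocation has a strictly positive variance, so the bias bound must stay strictly
  below \<epsilon>.\<close>

lemma feasible_imp_gap_pos:
  assumes "mlmc_feasible fdot T K Kinf m \<epsilon> L N"
  shows "0 < gap \<epsilon> L"
proof -
  have "0 < variance_scale * (\<Sum>l\<le>L. unit_cost l * (weight l)\<^sup>2 / N l)"
    using assms variance_scale_pos unit_cost_pos weight_pos
    by (intro mult_pos_pos sum_pos divide_pos_pos zero_less_power)
      (auto simp: mlmc_feasible_iff)
  then show ?thesis
    using assms by (simp add: mlmc_feasible_iff)
qed

text \<open>Cauchy--Schwarz bounds \<open>(Q L)\<^sup>2\<close> by cost times scaled variance, and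
  feasibility bounds the variance by the gap.\<close>

lemma opt_cost_le:
  assumes "mlmc_feasible fdot T K Kinf m \<epsilon> L N"
  shows "opt_cost \<epsilon> L \<le> mlmc_cost m L N"
proof -
  let ?V = "\<Sum>l\<le>L. unit_cost l * (weight l)\<^sup>2 / N l"
  have N: "0 < N l" if "l \<le> L" for l
    using assms that by (simp add: mlmc_feasible_iff)
  have cost: "0 \<le> mlmc_cost m L N"
    unfolding mlmc_cost_eq using N unit_cost_pos by (intro sum_nonneg) (simp add: less_imp_le)
  have "(Q L)\<^sup>2 \<le> mlmc_cost m L N * ?V"
    unfolding mlmc_cost_eq sum_unit_cost_weight[symmetric]
    using N unit_cost_pos by (intro weighted_Cauchy_Schwarz) (auto simp: less_imp_le)
  then have "(Q L)\<^sup>2 * variance_scale \<le> mlmc_cost m L N * ?V * variance_scale"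
    using variance_scale_pos by (intro mult_right_mono) auto
  also have "\<dots> \<le> mlmc_cost m L N * gap \<epsilon> L"
    using assms cost mult_left_mono[of "variance_scale * ?V" "gap \<epsilon> L" "mlmc_cost m L N"]
    by (simp add: mlmc_feasible_iff mult_ac)
  finally show ?thesis
    using feasible_imp_gap_pos[OF assms] by (simp add: opt_cost_def field_simps)
qed

lemma mlmc_cost_opt_alloc: "mlmc_cost m L (opt_alloc \<epsilon> L) = opt_cost \<epsilon> L"
proof -
  have "mlmc_cost m L (opt_alloc \<epsilon> L)
      = (\<Sum>l\<le>L. unit_cost l * weight l) * (Q L * (variance_scale / gap \<epsilon> L))"
    by (simp only: mlmc_cost_eq opt_alloc_def sum_distrib_right mult.assoc)
  then show ?thesis
    by (simp add: sum_unit_cost_weight opt_cost_def power2_eq_square)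
qed

text \<open>The common factor of the allocation is chosen so that the variance equals the gap: the
  constraint is active.\<close>

lemma opt_alloc_feasible:
  assumes "0 < gap \<epsilon> L"
  shows "mlmc_feasible fdot T K Kinf m \<epsilon> L (opt_alloc \<epsilon> L)"
proof -
  define c where "c = Q L * (variance_scale / gap \<epsilon> L)"
  have c: "0 < c"
    unfolding c_def using assms Q_pos variance_scale_pos by simp
  have "(\<Sum>l\<le>L. unit_cost l * (weight l)\<^sup>2 / opt_alloc \<epsilon> L l)
      = (\<Sum>l\<le>L. unit_cost l * weight l) / c"
    unfolding sum_divide_distrib opt_alloc_def c_def[symmetric]
    using c weight_pos
    by (intro sum.cong) (auto simp: power2_eq_square less_imp_neq[symmetric])
  also have "\<dots> = gap \<epsilon> L / variance_scale"
    using Q_pos[of L] assms by (simp add: sum_unit_cost_weight c_def)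
  finally show ?thesis
    using c weight_pos variance_scale_pos
    by (simp only: mlmc_feasible_iff opt_alloc_def c_def[symmetric]) simp
qed

lemma opt_alloc_is_arg_min:
  assumes "0 < gap \<epsilon> L"
  shows "is_arg_min (mlmc_cost m L) (mlmc_feasible fdot T K Kinf m \<epsilon> L) (opt_alloc \<epsilon> L)"
  using opt_alloc_feasible[OF assms] opt_cost_le
  by (auto simp: is_arg_min_def mlmc_cost_opt_alloc not_less)

section \<open>Comparison of an optimal level with its neighbours\<close>

lemma optimal_level_gap_pos:
  assumes "optimal_level fdot T K Kinf m \<epsilon> L"
  shows "0 < gap \<epsilon> L"
  using assms feasible_imp_gap_pos by (auto simp: optimal_level_def is_arg_min_def)

text \<open>Reduces optimality over pairs of level and allocation to optimality over levels: the
  optimal pair competes against \<open>L'\<close> with its best allocation, and its own cost is at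
  least \<open>opt_cost \<epsilon> L\<close>.\<close>

lemma optimal_level_opt_cost_le:
  assumes "optimal_level fdot T K Kinf m \<epsilon> L" "0 < gap \<epsilon> L'"
  shows "opt_cost \<epsilon> L \<le> opt_cost \<epsilon> L'"
proof -
  obtain N where min: "is_arg_min (\<lambda>(L, N). mlmc_cost m L N)
      (\<lambda>(L, N). mlmc_feasible fdot T K Kinf m \<epsilon> L N) (L, N)"
    using assms(1) unfolding optimal_level_def by (elim exE)
  have N: "mlmc_feasible fdot T K Kinf m \<epsilon> L N"
    "mlmc_feasible fdot T K Kinf m \<epsilon> L' N' \<Longrightarrow> mlmc_cost m L N \<le> mlmc_cost m L' N'" for L' N'
    using min by (auto simp: is_arg_min_def not_less)
  show ?thesis
    using opt_cost_le[OF N(1)] N(2)[OF opt_alloc_feasible[OF assms(2)]]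
    unfolding mlmc_cost_opt_alloc by (rule order_trans)
qed

text \<open>This explains \<open>s\<close>: it is \<open>CV\<close> divided by the prefactor of the
  geometric sum.\<close>

lemma Q_eq: "Q L = (real m + 1) / (real m * (r - 1)) * (1 + s - 1 / r ^ L)"
proof -
  have "real m powr (- (real L / 2)) = 1 / r ^ L"
    using m_ge by (intro powr_minus_half_nat) simp
  moreover have "CV = (real m + 1) / (real m * (r - 1)) * s"
    using m_ge r_gt_1 by (simp add: s_def)
  ultimately have "Q L = (real m + 1) / (real m * (r - 1)) * s
      + (real m + 1) / (real m * (r - 1)) * (1 - 1 / r ^ L)"
    by (simp add: Q_def)
  then show ?thesis
    by (simp only: distrib_left[symmetric]) (simp add: add_diff_eq add.commute)
qed

lemma gap_eq: "gap \<epsilon> L = A\<^sup>2 * ((\<epsilon> / A)\<^sup>2 - (1 / r ^ L) ^ 4)"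
proof -
  have "real m powr (- (2 * real L)) = real m powr (- (real (4 * L) / 2))"
    by simp
  also have "\<dots> = 1 / r ^ (4 * L)"
    using m_ge by (intro powr_minus_half_nat) simp
  also have "\<dots> = (1 / r ^ L) ^ 4"
    by (simp add: power_divide mult.commute flip: power_mult)
  finally show ?thesis
    using A_pos by (simp add: gap_def A_squared[symmetric] power_divide right_diff_distrib)
qed

text \<open>One constant serves all levels, so comparing levels means comparing the quotient at the
  points \<open>1 / r ^ L\<close>.\<close>

lemma opt_cost_eq:
  "\<exists>c>0. \<forall>L. opt_cost \<epsilon> L = c * ((1 + s - 1 / r ^ L)\<^sup>2 / ((\<epsilon> / A)\<^sup>2 - (1 / r ^ L) ^ 4))"
proof (intro exI conjI allI)
  show "0 < ((real m + 1) / (real m * (r - 1)))\<^sup>2 * (variance_scale / A\<^sup>2)"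
    using m_ge r_gt_1 variance_scale_pos A_pos
    by (intro mult_pos_pos divide_pos_pos zero_less_power) auto
qed (simp only: opt_cost_def Q_eq gap_eq power_mult_distrib times_divide_times_eq
      times_divide_eq_right times_divide_eq_left mult_ac divide_divide_eq_left power_divide)

lemma gap_pos_iff':
  "0 < gap \<epsilon> L \<longleftrightarrow> (1 / r ^ L) ^ 4 < (\<epsilon> / A)\<^sup>2"
  using A_pos by (simp add: gap_eq zero_less_mult_iff)

text \<open>At the point \<open>p\<close> of any other admissible level, the quotient decreases in
  the direction of \<open>q\<close>. Otherwise \<open>quotient_less\<close> would make
  \<open>L'\<close> strictly cheaper than \<open>L\<close>.\<close>

lemma optimal_level_not_critical:
  fixes \<epsilon> :: real and L L' :: nat
  assumes "optimal_level fdot T K Kinf m \<epsilon> L" "0 < gap \<epsilon> L'" "L \<noteq> L'"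
  defines "p \<equiv> 1 / r ^ L'" and "q \<equiv> 1 / r ^ L"
  shows "(q - p) * (2 * (1 + s) * p ^ 3 - p ^ 4 - (\<epsilon> / A)\<^sup>2) < 0"
proof (rule ccontr)
  assume neg: "\<not> ?thesis"
  have le1: "1 / r ^ k \<le> 1" for k
    using r_gt_1 by (simp add: less_imp_le)
  have "p \<noteq> q"
    using assms(3) r_gt_1 by (simp add: p_def q_def power_inject_exp)
  then have "(1 + s - p)\<^sup>2 / ((\<epsilon> / A)\<^sup>2 - p ^ 4) < (1 + s - q)\<^sup>2 / ((\<epsilon> / A)\<^sup>2 - q ^ 4)"
  proof (intro quotient_less)
    show "0 < p" "p < 1 + s" "q < 1 + s"
      using s_pos le1[of L] le1[of L'] r_gt_1 unfolding p_def q_def by (simp, linarith, linarith)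
    show "p ^ 4 < (\<epsilon> / A)\<^sup>2" "q ^ 4 < (\<epsilon> / A)\<^sup>2"
      using assms(2) optimal_level_gap_pos[OF assms(1)] by (simp_all only: gap_pos_iff' p_def q_def)
  qed (use neg in auto)
  moreover obtain c where "0 < c"
    "\<forall>L. opt_cost \<epsilon> L = c * ((1 + s - 1 / r ^ L)\<^sup>2 / ((\<epsilon> / A)\<^sup>2 - (1 / r ^ L) ^ 4))"
    using opt_cost_eq by blast
  ultimately have "opt_cost \<epsilon> L' < opt_cost \<epsilon> L"
    by (simp only: p_def q_def mult_less_cancel_left_pos)
  then show False
    using optimal_level_opt_cost_le[OF assms(1,2)] by simp
qed

text \<open>Comparison with \<open>Suc L\<close>, which is admissible because refinement enlarges
  the gap.\<close>

lemma optimal_level_fine: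
  assumes "optimal_level fdot T K Kinf m \<epsilon> L"
  shows "(1 / r ^ Suc L) ^ 3 * (2 * (1 + s) - 1 / r ^ Suc L) < (\<epsilon> / A)\<^sup>2"
proof -
  define p where "p = 1 / r ^ Suc L"
  have lt: "1 / r ^ Suc L < 1 / r ^ L"
    using r_gt_1 by (simp add: divide_simps)
  then have "(1 / r ^ Suc L) ^ 4 < (1 / r ^ L) ^ 4"
    using r_gt_1 by (intro power_strict_mono) auto
  then have "0 < gap \<epsilon> (Suc L)"
    using optimal_level_gap_pos[OF assms] by (simp add: gap_pos_iff' del: power_Suc)
  from optimal_level_not_critical[OF assms this]
  have "(1 / r ^ L - p) * (2 * (1 + s) * p ^ 3 - p ^ 4 - (\<epsilon> / A)\<^sup>2) < 0"
    by (simp add: p_def)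
  with lt[folded p_def] have "2 * (1 + s) * p ^ 3 - p ^ 4 < (\<epsilon> / A)\<^sup>2"
    by (auto simp: mult_less_0_iff simp flip: p_def)
  then show ?thesis
    unfolding p_def[symmetric] by (simp add: power4_eq_xxxx power3_eq_cube algebra_simps)
qed

text \<open>Comparison with \<open>L - 1\<close>, whose point is \<open>r / r ^ L\<close>. The cases
  in which this level does not exist or is not admissible are treated directly.\<close>

lemma optimal_level_coarse:
  assumes "optimal_level fdot T K Kinf m \<epsilon> L" "0 < \<epsilon>" "(\<epsilon> / A)\<^sup>2 < 1 + 2 * s"
  shows "(\<epsilon> / A)\<^sup>2 < 2 * (1 + s) * (r / r ^ L) ^ 3"
proof (cases L)
  \<comment> \<open>No coarser level exists; here the bound on \<epsilon> enters, through
    \<open>1 + 2 * s < 2 * (1 + s)\<close>.\<close>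
  case 0
  have "1 \<le> r ^ 3"
    using r_gt_1 by simp
  then have "2 * (1 + s) * 1 \<le> 2 * (1 + s) * r ^ 3"
    using s_pos by (intro mult_left_mono) auto
  then show ?thesis
    using assms(3) 0 by simp
next
  case (Suc k)
  define p where "p = 1 / r ^ k"
  have p: "0 < p" "p \<le> 1" "r / r ^ L = p"
    using r_gt_1 by (auto simp: p_def Suc)
  have lt: "1 / r ^ L < p"
    using r_gt_1 by (simp add: p_def Suc divide_simps)
  show ?thesis
  proof (cases "0 < gap \<epsilon> k")
    case True
    from optimal_level_not_critical[OF assms(1) this] lt
    have "(\<epsilon> / A)\<^sup>2 < 2 * (1 + s) * p ^ 3 - p ^ 4"
      by (simp add: Suc mult_less_0_iff flip: p_def)
    \<comment> \<open>Dropping the quartic term leaves an inequality that can be solved explicitly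
      for \<open>p\<close>.\<close>
    also have "\<dots> \<le> 2 * (1 + s) * p ^ 3"
      by simp
    finally show ?thesis by (simp add: p)
  next
    \<comment> \<open>The coarser level already violates the bias constraint, which by itself bounds
      \<open>(\<epsilon> / A)\<^sup>2\<close> by a power of \<open>p\<close>.\<close>
    case False
    then have "(\<epsilon> / A)\<^sup>2 \<le> p ^ 4"
      by (simp add: gap_pos_iff' p_def)
    also have "\<dots> \<le> p ^ 3"
      using p by (intro power_decreasing) auto
    also have "\<dots> < 2 * (1 + s) * p ^ 3"
      using p s_pos by simp
    finally show ?thesis by (simp add: p)
  qed
qed

section \<open>Explicit bounds for optimal levels and the order of the bias\<close>

lemma powr_minus_level: "real m powr (- real L) = 1 / (r ^ L)\<^sup>2"
  using m_ge powr_minus_half_nat[of "real m" "2 * L"]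
  by (simp add: mult.commute[of 2] flip: power_mult)

text \<open>The exponent 2/3 turns the cube of \<open>r / r ^ L\<close> in
  \<open>optimal_level_coarse\<close> into its square, which is \<open>m\<close> times the quantity
  to be bounded; this factor \<open>m\<close> is the cost of moving by one level.\<close>

lemma optimal_level_lower:
  assumes "optimal_level fdot T K Kinf m \<epsilon> L" "0 < \<epsilon>" "(\<epsilon> / A)\<^sup>2 < 1 + 2 * s"
  shows "\<epsilon> powr (4 / 3) / (2 powr (2 / 3) * real m * A powr (4 / 3) * (1 + s) powr (2 / 3))
       < real m powr (- real L)"
proof -
  have "(\<epsilon> / A)\<^sup>2 / (2 * (1 + s)) < (r / r ^ L) ^ 3"
    using optimal_level_coarse[OF assms] s_pos by (simp add: divide_less_eq mult.commute)
  then have "((\<epsilon> / A)\<^sup>2 / (2 * (1 + s))) powr (2 / 3) < ((r / r ^ L) ^ 3) powr (2 / 3)"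
    using s_pos by (intro powr_less_mono2) auto
  also have "\<dots> = real m * real m powr (- real L)"
  proof -
    have "0 < r / r ^ L"
      using r_gt_1 by simp
    then show ?thesis
      using cube_powr_two_thirds[of "r / r ^ L"]
      by (simp only: powr_minus_level power_divide r_squared) simp
  qed
  also have "((\<epsilon> / A)\<^sup>2 / (2 * (1 + s))) powr (2 / 3)
      = \<epsilon> powr (4 / 3) / A powr (4 / 3) / (2 powr (2 / 3) * (1 + s) powr (2 / 3))"
    using assms(2) A_pos s_pos square_powr_two_thirds[of "\<epsilon> / A"]
    by (simp add: powr_divide powr_mult del: distrib_left_numeral)
  finally have "\<epsilon> powr (4 / 3) / A powr (4 / 3) / (2 powr (2 / 3) * (1 + s) powr (2 / 3)) / real m
      < real m powr (- real L)"
    using m_ge by (subst pos_divide_less_eq) (auto simp: mult.commute)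
  then show ?thesis
    by (simp add: mult_ac)
qed

text \<open>Solves \<open>optimal_level_fine\<close> for \<open>p = 1 / r ^ Suc L\<close>; here
  \<open>m * p\<^sup>2\<close> is the quantity to be bounded.\<close>

lemma optimal_level_upper:
  assumes "optimal_level fdot T K Kinf m \<epsilon> L" "0 < \<epsilon>"
  shows "real m powr (- real L)
       < real m * \<epsilon> powr (4 / 3) / ((1 + s) * A powr (4 / 3))
         * ((1 + s) powr (1 / 3) / 2 powr (2 / 3) + (1 + 2 * s) powr (1 / 3) / (1 + 4 * s))"
proof -
  define p where "p = 1 / r ^ Suc L"
  define B where "B = (1 + s) powr (1 / 3) / 2 powr (2 / 3) + (1 + 2 * s) powr (1 / 3) / (1 + 4 * s)"
  have p: "0 < p" "p \<le> 1"
    using r_gt_1 one_le_power[of r "Suc L"] by (auto simp: p_def simp del: power_Suc)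
  have B: "0 < B"
    unfolding B_def using s_pos by (intro add_pos_pos divide_pos_pos) auto
  \<comment> \<open>Since \<open>p \<le> 1\<close>, the linear factor is replaced by its lower bound
    \<open>1 + 2 * s\<close>, which leaves a pure cube.\<close>
  have "p ^ 3 * (1 + 2 * s) \<le> p ^ 3 * (2 * (1 + s) - p)"
    using p by (intro mult_left_mono) auto
  also have "\<dots> < (\<epsilon> / A)\<^sup>2"
    using optimal_level_fine[OF assms(1)] by (simp only: p_def)
  finally have "(p ^ 3 * (1 + 2 * s)) powr (2 / 3) < ((\<epsilon> / A)\<^sup>2) powr (2 / 3)"
    using p s_pos by (intro powr_less_mono2) auto
  then have 1: "p\<^sup>2 * (1 + 2 * s) powr (2 / 3) < (\<epsilon> / A) powr (4 / 3)"
    using p s_pos assms(2) A_pos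
    by (simp add: powr_mult cube_powr_two_thirds square_powr_two_thirds)
  \<comment> \<open>Trades the factor \<open>(1 + 2 * s) powr (2 / 3)\<close> for the stated
    constant.\<close>
  have "1 + s < (1 + 2 * s) powr (2 / 3) * B"
    using upper_constant_gt[of "1 + s"] s_pos by (simp add: B_def algebra_simps)
  then have "p\<^sup>2 * (1 + s) \<le> p\<^sup>2 * (1 + 2 * s) powr (2 / 3) * B"
    using p by (simp add: mult.assoc mult_left_mono less_imp_le)
  also have "\<dots> < (\<epsilon> / A) powr (4 / 3) * B"
    using 1 B by (rule mult_strict_right_mono)
  finally have "p\<^sup>2 < (\<epsilon> / A) powr (4 / 3) * B / (1 + s)"
    using s_pos by (simp add: less_divide_eq)
  then have "real m * p\<^sup>2 < real m * ((\<epsilon> / A) powr (4 / 3) * B / (1 + s))"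
    using m_ge by (intro mult_strict_left_mono) auto
  moreover have "real m powr (- real L) = real m * p\<^sup>2"
    using m_ge by (simp add: powr_minus_level p_def power_divide power_mult_distrib)
  ultimately show ?thesis
    using assms(2) A_pos by (simp add: powr_divide mult_ac flip: B_def)
qed

lemma less_threshold_iff:
  assumes "0 < \<epsilon>"
  shows "\<epsilon> < A * (1 + 2 * s) powr (1 / 2) \<longleftrightarrow> (\<epsilon> / A)\<^sup>2 < 1 + 2 * s"
proof -
  have "\<epsilon> < A * (1 + 2 * s) powr (1 / 2) \<longleftrightarrow> \<epsilon> / A < sqrt (1 + 2 * s)"
    using A_pos s_pos by (simp add: powr_half_sqrt pos_divide_less_eq mult.commute)
  also have "\<dots> \<longleftrightarrow> sqrt ((\<epsilon> / A)\<^sup>2) < sqrt (1 + 2 * s)"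
    using assms A_pos by simp
  finally show ?thesis
    by (simp only: real_sqrt_less_iff)
qed

text \<open>For any choice of optimal levels, the upper bound holds on all of \<open>(0, c)\<close>
  and is a fixed multiple of \<open>\<epsilon> powr (4 / 3)\<close>.\<close>

lemma optimal_level_bias_bigo:
  assumes "\<forall>\<epsilon>\<in>{0<..<c}. optimal_level fdot T K Kinf m \<epsilon> (L\<epsilon> \<epsilon>)" "0 < c"
  shows "(\<lambda>\<epsilon>. A * real m powr (- real (L\<epsilon> \<epsilon>))) \<in> O[at_right 0](\<lambda>\<epsilon>. \<epsilon> powr (4 / 3))"
proof (rule bigoI)
  let ?B = "(1 + s) powr (1 / 3) / 2 powr (2 / 3) + (1 + 2 * s) powr (1 / 3) / (1 + 4 * s)"
  show "\<forall>\<^sub>F \<epsilon> in at_right 0. norm (A * real m powr (- real (L\<epsilon> \<epsilon>)))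
      \<le> A * (real m / ((1 + s) * A powr (4 / 3)) * ?B) * norm (\<epsilon> powr (4 / 3))"
    unfolding eventually_at_right_field
  proof (intro exI conjI allI impI)
    fix \<epsilon> :: real
    assume "0 < \<epsilon>" "\<epsilon> < c"
    then have "real m powr (- real (L\<epsilon> \<epsilon>))
        \<le> real m * \<epsilon> powr (4 / 3) / ((1 + s) * A powr (4 / 3)) * ?B"
      using assms(1) by (intro less_imp_le optimal_level_upper) auto
    also have "\<dots> = real m / ((1 + s) * A powr (4 / 3)) * ?B * \<epsilon> powr (4 / 3)"
      by (simp only: times_divide_eq_left times_divide_eq_right mult_ac)
    finally have "A * real m powr (- real (L\<epsilon> \<epsilon>))
        \<le> A * (real m / ((1 + s) * A powr (4 / 3)) * ?B * \<epsilon> powr (4 / 3))"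
      using A_pos by (intro mult_left_mono) auto
    then show "norm (A * real m powr (- real (L\<epsilon> \<epsilon>)))
      \<le> A * (real m / ((1 + s) * A powr (4 / 3)) * ?B) * norm (\<epsilon> powr (4 / 3))"
      using A_pos by (simp only: real_norm_def abs_mult abs_of_pos abs_of_nonneg powr_ge_zero mult.assoc)
  qed (use assms in auto)
qed

end

section \<open>Specialization to the constants of the drift\<close>

theorem mainTheorem8:
  fixes b :: "real ^ 'd \<Rightarrow> real ^ 'd" and x0 :: "real ^ 'd"
    and T bdot a fdot :: real and m :: nat
  assumes "0 < T"
    and "R1 b x0 bdot a"
    and "0 < fdot"
    and "2 \<le> m"
  defines "K \<equiv> K1 b x0 bdot a T (enat m)"
    and "Kinf \<equiv> K1 b x0 bdot a T \<infinity>"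
  defines "CV \<equiv> 1 / real m * sqrt ((real m + 1) / (K * (real m - 1) * T))"
  defines "s \<equiv> real m * (sqrt (real m) - 1) / (real m + 1) * CV"
  defines "A \<equiv> fdot * T * sqrt Kinf"
  defines "c1 \<equiv> A * (1 + 2 * s) powr (1 / 2)"
  shows
    "(\<forall>\<epsilon>>0. \<forall>L::nat. A * real m powr (- real L) < \<epsilon> \<longrightarrow>
        (let S = CV + (\<Sum>l=1..L. real m powr (- (3 * real l / 2)));
             Q = CV + (real m + 1) / real m
                       * ((1 - real m powr (- (real L / 2))) / (sqrt (real m) - 1));
             R = K * (real m)\<^sup>2 * (real m - 1) * fdot\<^sup>2 * T\<^sup>2
                   / ((real m + 1)
                      * (\<epsilon>\<^sup>2 - fdot\<^sup>2 * T\<^sup>2 * Kinf * real m powr (- (2 * real L))));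
             N = S * Q * R;
             Nopt = (\<lambda>l::nat. if l = 0 then N * (CV / S)
                              else N * (real m powr (- (3 * real l / 2)) / S))
         in is_arg_min (mlmc_cost m L) (mlmc_feasible fdot T K Kinf m \<epsilon> L) Nopt
            \<and> mlmc_cost m L Nopt = Q\<^sup>2 * R))
     \<and>
     (\<forall>\<epsilon> L. 0 < \<epsilon> \<and> \<epsilon> < c1 \<and> optimal_level fdot T K Kinf m \<epsilon> L \<longrightarrow>
        \<epsilon> powr (4 / 3)
            / (2 powr (2 / 3) * real m * A powr (4 / 3) * (1 + s) powr (2 / 3))
          < real m powr (- real L)
        \<and> real m powr (- real L)
          < real m * \<epsilon> powr (4 / 3) / ((1 + s) * A powr (4 / 3))
            * ((1 + s) powr (1 / 3) / 2 powr (2 / 3)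
               + (1 + 2 * s) powr (1 / 3) / (1 + 4 * s)))
     \<and>
     (\<forall>L\<epsilon> :: real \<Rightarrow> nat.
        (\<forall>\<epsilon>\<in>{0<..<c1}. optimal_level fdot T K Kinf m \<epsilon> (L\<epsilon> \<epsilon>)) \<longrightarrow>
        (\<lambda>\<epsilon>. A * real m powr (- real (L\<epsilon> \<epsilon>))) \<in> O[at_right 0](\<lambda>\<epsilon>. \<epsilon> powr (4 / 3)))"
proof -
  interpret mlmc m T K Kinf fdot
  proof
    have "2 \<le> enat m" using assms(4) by (simp add: numeral_eq_enat)
    then show "0 < K" unfolding K_def using assms(1,2) by (rule K1_pos[rotated 2])
    show "0 < Kinf" unfolding Kinf_def using assms(1,2) by (rule K1_pos) simp
  qed (use assms(1,3,4) in auto)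
  \<comment> \<open>Unqualified \<open>CV\<close>, \<open>s\<close> and \<open>A\<close> are those
    of the statement; the qualified names are the constants of the locale.\<close>
  have eqs: "CV = mlmc.CV m T K" "s = mlmc.s m T K" "A = mlmc.A T Kinf fdot"
    by (simp_all only: CV_def s_def A_def assms(7-9))
  \<comment> \<open>The \<open>let\<close>-bound quantities appear as variables with defining
    equations, so that \<open>refl\<close> can instantiate them below.\<close>
  have allocation: "is_arg_min (mlmc_cost m L) (mlmc_feasible fdot T K Kinf m \<epsilon> L) Nopt
      \<and> mlmc_cost m L Nopt = Q'\<^sup>2 * R"
    if "0 < \<epsilon>" "A * real m powr (- real L) < \<epsilon>"
      and S_def: "S = CV + (\<Sum>l=1..L. real m powr (- (3 * real l / 2)))"
      and Q_def: "Q' = CV + (real m + 1) / real m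
                       * ((1 - real m powr (- (real L / 2))) / (sqrt (real m) - 1))"
      and R_def: "R = K * (real m)\<^sup>2 * (real m - 1) * fdot\<^sup>2 * T\<^sup>2
                   / ((real m + 1)
                      * (\<epsilon>\<^sup>2 - fdot\<^sup>2 * T\<^sup>2 * Kinf * real m powr (- (2 * real L))))"
      and N_def: "N = S * Q' * R"
      and Nopt_def: "Nopt = (\<lambda>l::nat. if l = 0 then N * (CV / S)
                              else N * (real m powr (- (3 * real l / 2)) / S))"
    for \<epsilon> S Q' R N :: real and L :: nat and Nopt :: "nat \<Rightarrow> real"
  proof -
    have "0 < gap \<epsilon> L"
      using that(1,2) by (simp only: gap_pos_iff eqs)
    moreover have "Q' = Q L"
      by (simp only: Q_def mlmc.Q_def[OF mlmc_axioms] eqs)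
    moreover have "R = variance_scale / gap \<epsilon> L"
      by (simp add: R_def variance_scale_def gap_def)
    moreover have "Nopt = opt_alloc \<epsilon> L"
    proof
      fix l
      \<comment> \<open>The normalizing sum \<open>S\<close> occurs in \<open>N\<close> and in the
        denominator of each proportion; being nonzero, it cancels.\<close>
      have "0 < S"
        unfolding S_def eqs using CV_pos by (intro add_pos_nonneg sum_nonneg) auto
      then show "Nopt l = opt_alloc \<epsilon> L l"
        unfolding Nopt_def N_def opt_alloc_def weight_def calculation eqs by simp
    qed
    ultimately show ?thesis
      using opt_alloc_is_arg_min mlmc_cost_opt_alloc by (simp add: opt_cost_def)
  qed
  have "0 < c1"
    using A_pos s_pos by (simp add: c1_def eqs)
  have threshold: "(\<epsilon> / mlmc.A T Kinf fdot)\<^sup>2 < 1 + 2 * mlmc.s m T K" if "0 < \<epsilon>" "\<epsilon> < c1" for \<epsilon>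
    using that less_threshold_iff by (simp add: c1_def eqs)
  show ?thesis
  proof (intro conjI allI impI)
    fix \<epsilon> :: real and L :: nat
    assume "0 < \<epsilon> \<and> \<epsilon> < c1 \<and> optimal_level fdot T K Kinf m \<epsilon> L"
    then have opt: "0 < \<epsilon>" "\<epsilon> < c1" "optimal_level fdot T K Kinf m \<epsilon> L"
      by auto
    show "\<epsilon> powr (4 / 3)
            / (2 powr (2 / 3) * real m * A powr (4 / 3) * (1 + s) powr (2 / 3))
          < real m powr (- real L)"
      unfolding eqs using opt by (intro optimal_level_lower threshold)
    show "real m powr (- real L)
          < real m * \<epsilon> powr (4 / 3) / ((1 + s) * A powr (4 / 3))
            * ((1 + s) powr (1 / 3) / 2 powr (2 / 3)
               + (1 + 2 * s) powr (1 / 3) / (1 + 4 * s))"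
      unfolding eqs using opt by (intro optimal_level_upper)
  next
    fix L\<epsilon> :: "real \<Rightarrow> nat"
    assume "\<forall>\<epsilon>\<in>{0<..<c1}. optimal_level fdot T K Kinf m \<epsilon> (L\<epsilon> \<epsilon>)"
    then show "(\<lambda>\<epsilon>. A * real m powr (- real (L\<epsilon> \<epsilon>))) \<in> O[at_right 0](\<lambda>\<epsilon>. \<epsilon> powr (4 / 3))"
      unfolding eqs using \<open>0 < c1\<close> by (rule optimal_level_bias_bigo)
  next
    fix \<epsilon> :: real and L :: nat
    assume "0 < \<epsilon>" "A * real m powr (- real L) < \<epsilon>"
    from allocation[OF this refl refl refl refl refl]
    show "let S = CV + (\<Sum>l=1..L. real m powr (- (3 * real l / 2)));
             Q = CV + (real m + 1) / real m
                       * ((1 - real m powr (- (real L / 2))) / (sqrt (real m) - 1));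
             R = K * (real m)\<^sup>2 * (real m - 1) * fdot\<^sup>2 * T\<^sup>2
                   / ((real m + 1)
                      * (\<epsilon>\<^sup>2 - fdot\<^sup>2 * T\<^sup>2 * Kinf * real m powr (- (2 * real L))));
             N = S * Q * R;
             Nopt = (\<lambda>l::nat. if l = 0 then N * (CV / S)
                              else N * (real m powr (- (3 * real l / 2)) / S))
         in is_arg_min (mlmc_cost m L) (mlmc_feasible fdot T K Kinf m \<epsilon> L) Nopt
            \<and> mlmc_cost m L Nopt = Q\<^sup>2 * R"
      unfolding Let_def .
  qed
qed

end
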